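(* Let $\Sigma=\{0,1\}$ and let $S=\{s_1,s_2,s_3\}$ be a set of three binary strings in $\Sigma^n$. Let $D^*=\min_{u\in\Sigma^n}\max_{1\le i\le 3} d(u,s_i)$ be the optimal closest-string distance, and let $t$ be the string output by Algorithm A (described in the context) on $S$. Then the error of Algorithm A is at most one, i.e. $\max_{1\le i\le 3} d(t,s_i)-D^*\le 1$.
   Context: For equal-length strings $s,t$, $d(s,t)$ is the Hamming distance (number of positions $i$ with $s[i]\neq t[i]$). The closest string problem (CSP): given $S=\{s_1,\dots,s_m\}\subseteq\Sigma^n$, find $t\in\Sigma^n$ minimizing $d$ subject to $d(t,s_i)\le d$ for all $i$. It is formulated as the integer program: minimize $d$ subject to $\sum_{a\in\Sigma}x_{a,j}=1$ for $j=1,\dots,n$, and $n-\sum_{j=1}^n x_{s_i[j],j}\le d$ for $i=1,\dots,m$, with $x_{a,j}\in\{0,1\}$ and $d$ a nonnegative integer ($x_{a,j}=1$ means $t[j]=a$). Its LP relaxation replaces $x_{a,j}\in\{0,1\}$ by $0\le x_{a,j}\le 1$ and lets $d$ be real. Algorithm A: start with $V_1=V_0=\emptyset$. For $i=1,\dots,n$: fix all variables in $V_1$ to $1$ and all variables in $V_0$ to $0$; solve the LP relaxation in the remaining (unfixed) variables; pick a variable $x_{b,k}$ not in $V_1$ having the largest value in this LP optimal solution; add $x_{b,k}$ to $V_1$ and add all $x_{a,k}$ with $a\neq b$ to $V_0$. Finally output the string $t$ with $t[k]=a$ for every $x_{a,k}\in V_1$. The error of the algorithm is the difference between the distance of the solution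 it obtains and the optimal distance. *)

theory Defs
  imports Complex_Main
begin

text \<open>
  Strings of length \<open>n\<close> over an alphabet \<open>A\<close> are lists; positions are \<open>0, \<dots>, n - 1\<close>.
\<close>

definition strings :: "'a set \<Rightarrow> nat \<Rightarrow> 'a list set" where
  "strings A n = {s. set s \<subseteq> A \<and> length s = n}"

definition hamming :: "'a list \<Rightarrow> 'a list \<Rightarrow> nat" where
  "hamming s t = card {i. i < length s \<and> s ! i \<noteq> t ! i}"

definition max_dist :: "'a list \<Rightarrow> 'a list set \<Rightarrow> nat" where
  "max_dist u S = Max ((\<lambda>s. hamming u s) ` S)"

definition opt_dist :: "'a set \<Rightarrow> nat \<Rightarrow> 'a list set \<Rightarrow> nat" where
  "opt_dist A n S = Min ((\<lambda>u. max_dist u S) ` strings A n)"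

text \<open>
  The LP relaxation in which the variables \<open>x a j\<close> with \<open>(a, j) \<in> V1\<close> are fixed to \<open>1\<close> and those
  with \<open>(a, j) \<in> V0\<close> are fixed to \<open>0\<close>. Only the values \<open>x a j\<close> with \<open>a \<in> A\<close> and \<open>j < n\<close> are LP
  variables; other values of the function \<open>x\<close> are irrelevant.
\<close>

definition lp_feasible ::
  "'a set \<Rightarrow> nat \<Rightarrow> 'a list set \<Rightarrow> ('a \<times> nat) set \<Rightarrow> ('a \<times> nat) set \<Rightarrow>
    ('a \<Rightarrow> nat \<Rightarrow> real) \<Rightarrow> real \<Rightarrow> bool" where
  "lp_feasible A n S V1 V0 x d \<longleftrightarrow>
     (\<forall>j<n. (\<Sum>a\<in>A. x a j) = 1) \<and>
     (\<forall>s\<in>S. real n - (\<Sum>j<n. x (s ! j) j) \<le> d) \<and>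
     (\<forall>a\<in>A. \<forall>j<n. 0 \<le> x a j \<and> x a j \<le> 1) \<and>
     0 \<le> d \<and>
     (\<forall>(a, j)\<in>V1. x a j = 1) \<and>
     (\<forall>(a, j)\<in>V0. x a j = 0)"

definition lp_optimal ::
  "'a set \<Rightarrow> nat \<Rightarrow> 'a list set \<Rightarrow> ('a \<times> nat) set \<Rightarrow> ('a \<times> nat) set \<Rightarrow>
    ('a \<Rightarrow> nat \<Rightarrow> real) \<Rightarrow> real \<Rightarrow> bool" where
  "lp_optimal A n S V1 V0 x d \<longleftrightarrow>
     lp_feasible A n S V1 V0 x d \<and>
     (\<forall>x' d'. lp_feasible A n S V1 V0 x' d' \<longrightarrow> d \<le> d')"

text \<open>
  \<open>algA_state A n S i V1 V0\<close>: the pair \<open>(V1, V0)\<close> can be reached after \<open>i\<close> iterations of the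
  rounding algorithm. It is a relation rather than a function because neither the choice among
  several optimal LP solutions nor the choice among several largest variables is prescribed.
\<close>

inductive algA_state ::
  "'a set \<Rightarrow> nat \<Rightarrow> 'a list set \<Rightarrow> nat \<Rightarrow> ('a \<times> nat) set \<Rightarrow> ('a \<times> nat) set \<Rightarrow> bool"
  for A :: "'a set" and n :: nat and S :: "'a list set" where
  init: "algA_state A n S 0 {} {}"
| step: "\<lbrakk>algA_state A n S i V1 V0; i < n; lp_optimal A n S V1 V0 x d;
          b \<in> A; k < n; (b, k) \<notin> V1;
          \<And>a j. \<lbrakk>a \<in> A; j < n; (a, j) \<notin> V1\<rbrakk> \<Longrightarrow> x a j \<le> x b k\<rbrakk>
         \<Longrightarrow> algA_state A n S (Suc i) (insert (b, k) V1) (V0 \<union> {(a, k) | a. a \<in> A \<and> a \<noteq> b})"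

definition algA_output :: "'a set \<Rightarrow> nat \<Rightarrow> 'a list set \<Rightarrow> 'a list \<Rightarrow> bool" where
  "algA_output A n S t \<longleftrightarrow>
     t \<in> strings A n \<and> (\<exists>V1 V0. algA_state A n S n V1 V0 \<and> (\<forall>(a, k)\<in>V1. t ! k = a))"

end

theory Submission
  imports Defs
begin

text \<open>
  Call the type of a column the way in which it partitions the three strings. If every unfixed
  variable of an optimal LP solution is below \<open>1\<close>, at most two types occur among the unfixed
  columns, since otherwise shifting a little weight towards the majority letters would improve
  all three distances. Rounding up a largest variable \<open>v \<ge> 1/2\<close> costs nothing if another
  unfixed column has the same type: that column has weight at least \<open>1 - v\<close> on the corresponding
  letter and can absorb the change. Otherwise rounding costs at most \<open>1 - v \<le> 1/2\<close> and one of the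
  at most two remaining types disappears. So the LP value grows by at most \<open>1\<close> in total.
\<close>

section \<open>Binary LP solutions and states of the algorithm\<close>

definition unit_columns :: "nat \<Rightarrow> (nat \<Rightarrow> nat \<Rightarrow> real) \<Rightarrow> bool" where
  "unit_columns n x \<longleftrightarrow> (\<forall>j<n. 0 \<le> x 0 j \<and> 0 \<le> x 1 j \<and> x 0 j + x 1 j = 1)"

definition lp_cost :: "nat \<Rightarrow> ('a \<Rightarrow> nat \<Rightarrow> real) \<Rightarrow> 'a list \<Rightarrow> real" where
  "lp_cost n x s = real n - (\<Sum>j<n. x (s ! j) j)"

text \<open>A state \<open>(V1, V0)\<close> is encoded by the set \<open>F\<close> of fixed columns
  and the letters \<open>p j\<close> chosen there; only the values of \<open>p\<close> on
  \<open>F\<close> count. In \<open>fixed_to_zero\<close>, \<open>1 - p j\<close> is the other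
  binary letter.\<close>

definition fixed_to_one :: "nat set \<Rightarrow> (nat \<Rightarrow> nat) \<Rightarrow> (nat \<times> nat) set" where
  "fixed_to_one F p = (\<lambda>j. (p j, j)) ` F"

definition fixed_to_zero :: "nat set \<Rightarrow> (nat \<Rightarrow> nat) \<Rightarrow> (nat \<times> nat) set" where
  "fixed_to_zero F p = (\<lambda>j. (1 - p j, j)) ` F"

text \<open>On a binary alphabet these two bits determine the partition: \<open>(True, True)\<close>
  is a unanimous column, and in each other case exactly one string is in the minority, namely
  \<open>s1\<close> for \<open>(False, False)\<close>.\<close>

definition col_type :: "'a list \<Rightarrow> 'a list \<Rightarrow> 'a list \<Rightarrow> nat \<Rightarrow> bool \<times> bool" where
  "col_type s1 s2 s3 j = (s1 ! j = s2 ! j, s1 ! j = s3 ! j)"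

text \<open>With two letters the column sums are preserved, and a positive \<open>e j\<close> moves
  weight towards the letter \<open>M j\<close>.\<close>

definition shift :: "(nat \<Rightarrow> nat) \<Rightarrow> (nat \<Rightarrow> real) \<Rightarrow> (nat \<Rightarrow> nat \<Rightarrow> real) \<Rightarrow> nat \<Rightarrow> nat \<Rightarrow> real" where
  "shift M e x a j = x a j + (if a = M j then e j else - e j)"

lemma binary_letter:
  assumes "s \<in> strings {0, 1 :: nat} n" and "j < n"
  shows "s ! j = 0 \<or> s ! j = 1"
proof -
  have "s ! j \<in> {0, 1}"
    using assms nth_mem unfolding strings_def by blast
  then show ?thesis
    by simp
qed

text \<open>With two letters, the unit column sum turns a variable fixed to 1 into a zero for the
  other letter, and nonnegativity gives the upper bounds. Hence neither the zero fixings nor the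
  upper bounds appear on the right.\<close>

lemma lp_feasible_binary_iff:
  assumes "F \<subseteq> {..<n}" and "p ` F \<subseteq> {0, 1}"
  shows "lp_feasible {0, 1} n S (fixed_to_one F p) (fixed_to_zero F p) x d \<longleftrightarrow>
    unit_columns n x \<and> (\<forall>j\<in>F. x (p j) j = 1) \<and> (\<forall>s\<in>S. lp_cost n x s \<le> d) \<and> 0 \<le> d"
    (is "?L \<longleftrightarrow> ?R")
proof
  show "?L \<Longrightarrow> ?R"
    by (auto simp: lp_feasible_def unit_columns_def lp_cost_def fixed_to_one_def)
next
  assume R: ?R
  then have u: "\<And>j. j < n \<Longrightarrow> 0 \<le> x 0 j \<and> 0 \<le> x 1 j \<and> x 0 j + x 1 j = 1"
    by (auto simp: unit_columns_def)
  have "x (1 - p j) j = 0" if "j \<in> F" for j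
  proof -
    have "j < n" "p j = 0 \<or> p j = 1" "x (p j) j = 1"
      using R assms that by auto
    then show ?thesis
      using u[of j] by auto
  qed
  moreover have "x a j \<le> 1" if "a \<in> {0, 1}" "j < n" for a j
    using u[of j] that by auto
  ultimately show ?L
    using R u by (auto simp: lp_feasible_def lp_cost_def fixed_to_one_def fixed_to_zero_def)
qed

text \<open>Links the LP to strings at both ends of the argument: for an optimal string as the
  initial solution, and for the output.\<close>

lemma lp_cost_integral:
  assumes "unit_columns n x" and "u \<in> strings {0, 1} n" and "s \<in> strings {0, 1} n"
    and "\<And>j. j < n \<Longrightarrow> x (u ! j) j = 1"
  shows "lp_cost n x s = real (hamming u s)"
proof -
  have "x (s ! j) j = (if u ! j \<noteq> s ! j then 0 else 1)" if "j < n" for j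
  proof -
    have "0 \<le> x 0 j \<and> 0 \<le> x 1 j \<and> x 0 j + x 1 j = 1"
      using assms(1) that by (auto simp: unit_columns_def)
    then show ?thesis
      using assms(4)[OF that] binary_letter[OF assms(2) that]
        binary_letter[OF assms(3) that] by auto
  qed
  then have "lp_cost n x s = (\<Sum>j<n. 1 - (if u ! j \<noteq> s ! j then 0 else 1))"
    by (simp add: lp_cost_def sum_subtractf)
  also have "\<dots> = (\<Sum>j\<in>{j. j < n \<and> u ! j \<noteq> s ! j}. 1)"
    by (rule sum.mono_neutral_cong_right) auto
  also have "\<dots> = real (hamming u s)"
    using assms(2) by (simp add: hamming_def strings_def)
  finally show ?thesis .
qed

lemma lp_cost_nonneg:
  assumes "unit_columns n x" and "s \<in> strings {0, 1} n"
  shows "0 \<le> lp_cost n x s"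
proof -
  have "x (s ! j) j \<le> 1" if "j < n" for j
  proof -
    have "0 \<le> x 0 j \<and> 0 \<le> x 1 j \<and> x 0 j + x 1 j = 1"
      using assms(1) that by (auto simp: unit_columns_def)
    then show ?thesis
      using binary_letter[OF assms(2) that] by auto
  qed
  then have "(\<Sum>j<n. x (s ! j) j) \<le> (\<Sum>j<n. 1)"
    by (intro sum_mono) auto
  then show ?thesis
    by (simp add: lp_cost_def)
qed

section \<open>Shifting weight inside columns\<close>

lemma unit_columns_shift:
  assumes "unit_columns n x"
    and "\<And>j. j < n \<Longrightarrow> M j \<in> {0, 1}"
    and "\<And>j. j < n \<Longrightarrow> 0 \<le> x (M j) j + e j \<and> x (M j) j + e j \<le> 1"
  shows "unit_columns n (shift M e x)"
  unfolding unit_columns_def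
proof (intro allI impI)
  fix j assume "j < n"
  then have "0 \<le> x 0 j \<and> 0 \<le> x 1 j \<and> x 0 j + x 1 j = 1"
    using assms(1) by (auto simp: unit_columns_def)
  then show "0 \<le> shift M e x 0 j \<and> 0 \<le> shift M e x 1 j \<and> shift M e x 0 j + shift M e x 1 j = 1"
    using assms(3)[OF \<open>j < n\<close>] assms(2)[OF \<open>j < n\<close>] by (cases "M j = 0") (simp_all add: shift_def)
qed

lemma lp_cost_shift:
  "lp_cost n (shift M e x) s = lp_cost n x s - (\<Sum>j<n. if s ! j = M j then e j else - e j)"
  by (simp add: lp_cost_def shift_def sum.distrib)

section \<open>Column types in fractional optimal solutions\<close>

text \<open>If every string agrees with \<open>M\<close> on more columns of \<open>C\<close> than it
  disagrees, moving the same small weight towards \<open>M\<close> in all of \<open>C\<close> lowers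
  every cost, against optimality.\<close>

lemma optimal_no_majority_shift:
  assumes F: "F \<subseteq> {..<n}" "p ` F \<subseteq> {0, 1}"
    and opt: "lp_optimal {0, 1} n S (fixed_to_one F p) (fixed_to_zero F p) x d"
    and S: "S \<noteq> {}" "S \<subseteq> strings {0, 1} n"
    and C: "C \<subseteq> {..<n} - F" "C \<noteq> {}"
    and M: "\<And>j. j < n \<Longrightarrow> M j \<in> {0, 1}"
    and frac: "\<And>j. j \<in> C \<Longrightarrow> x (M j) j < 1"
    and maj: "\<And>s. s \<in> S \<Longrightarrow> 1 \<le> (\<Sum>j\<in>C. if s ! j = M j then 1 else - 1 :: real)"
  shows False
proof -
  have fin: "finite C"
    using C(1) finite_subset by blast
  \<comment> \<open>The largest common shift that keeps all weights \<open>x (M j) j\<close> on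
    \<open>C\<close> at most 1; it is attained on the finite set \<open>C\<close>, hence
    positive.\<close>
  define \<epsilon> where "\<epsilon> = Min ((\<lambda>j. 1 - x (M j) j) ` C)"
  have "\<epsilon> \<in> (\<lambda>j. 1 - x (M j) j) ` C"
    unfolding \<epsilon>_def using fin C(2) by (intro Min_in) auto
  with frac have pos: "0 < \<epsilon>"
    by auto
  have le: "\<epsilon> \<le> 1 - x (M j) j" if "j \<in> C" for j
    unfolding \<epsilon>_def using fin that by (intro Min_le) auto
  have feas: "unit_columns n x" "\<forall>j\<in>F. x (p j) j = 1" "\<forall>s\<in>S. lp_cost n x s \<le> d"
    using opt unfolding lp_optimal_def lp_feasible_binary_iff[OF F] by auto
  have u: "0 \<le> x (M j) j \<and> x (M j) j \<le> 1" if "j < n" for j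
  proof -
    have "0 \<le> x 0 j \<and> 0 \<le> x 1 j \<and> x 0 j + x 1 j = 1"
      using feas(1) that by (auto simp: unit_columns_def)
    then show ?thesis
      using M[OF that] by auto
  qed
  define e where "e j = (if j \<in> C then \<epsilon> else 0)" for j
  have unit: "unit_columns n (shift M e x)"
  proof (rule unit_columns_shift[OF feas(1) M])
    fix j assume "j < n"
    then show "0 \<le> x (M j) j + e j \<and> x (M j) j + e j \<le> 1"
      using u[of j] le[of j] pos by (auto simp: e_def)
  qed
  have "shift M e x (p j) j = 1" if "j \<in> F" for j
    using that C feas(2) by (auto simp: shift_def e_def)
  moreover have cost: "lp_cost n (shift M e x) s \<le> d - \<epsilon>" if "s \<in> S" for s
  proof -
    have "(\<Sum>j<n. if s ! j = M j then e j else - e j)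
        = (\<Sum>j\<in>C. \<epsilon> * (if s ! j = M j then 1 else - 1))"
      using C(1) by (intro sum.mono_neutral_cong_right) (auto simp: e_def)
    also have "\<dots> = \<epsilon> * (\<Sum>j\<in>C. if s ! j = M j then 1 else - 1)"
      by (rule sum_distrib_left[symmetric])
    also have "\<dots> \<ge> \<epsilon>"
      using maj[OF that] pos by simp
    finally show ?thesis
      using feas(3) that by (force simp: lp_cost_shift)
  qed
  \<comment> \<open>The LP also demands a nonnegative bound; this holds since
    \<open>d - \<epsilon>\<close> is above some cost, and costs are nonnegative.\<close>
  moreover have "0 \<le> d - \<epsilon>"
  proof -
    obtain s where "s \<in> S"
      using S(1) by blast
    then show ?thesis
      using cost[of s] lp_cost_nonneg[OF unit, of s] S(2) by auto
  qed
  ultimately have "lp_feasible {0, 1} n S (fixed_to_one F p) (fixed_to_zero F p) (shift M e x) (d - \<epsilon>)"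
    unfolding lp_feasible_binary_iff[OF F] using unit by blast
  then have "d \<le> d - \<epsilon>"
    using opt by (auto simp: lp_optimal_def)
  with pos show False
    by simp
qed

text \<open>A unanimous column alone allows an improving shift. So do three columns, one of each
  remaining type, because every string is in the minority in only one of them.\<close>

lemma fractional_col_types:
  assumes F: "F \<subseteq> {..<n}" "p ` F \<subseteq> {0, 1}"
    and opt: "lp_optimal {0, 1} n {s1, s2, s3} (fixed_to_one F p) (fixed_to_zero F p) x d"
    and S: "{s1, s2, s3} \<subseteq> strings {0, 1} n"
    and frac: "\<And>j a. j \<in> {..<n} - F \<Longrightarrow> a \<in> {0, 1} \<Longrightarrow> x a j < 1"
  shows "card (col_type s1 s2 s3 ` ({..<n} - F)) \<le> 2"
proof (rule ccontr)
  let ?T = "col_type s1 s2 s3 ` ({..<n} - F)"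
  assume "\<not> ?thesis"
  then have big: "card ?T > 2"
    by simp
  have letter: "s1 ! j = 0 \<or> s1 ! j = 1" "s2 ! j = 0 \<or> s2 ! j = 1" "s3 ! j = 0 \<or> s3 ! j = 1"
    if "j < n" for j
    using S that binary_letter[of _ n j] by blast+
  \<comment> \<open>The majority letter: if \<open>s1\<close> and \<open>s2\<close> differ,
    \<open>s3\<close> agrees with one of them.\<close>
  define M where "M j = (if s1 ! j = s2 ! j then s1 ! j else s3 ! j)" for j
  have M: "M j \<in> {0, 1}" if "j < n" for j
    using letter[OF that] by (auto simp: M_def)
  have no_shift: False if "C \<subseteq> {..<n} - F" "C \<noteq> {}"
    "\<And>s. s \<in> {s1, s2, s3} \<Longrightarrow> 1 \<le> (\<Sum>j\<in>C. if s ! j = M j then 1 else - 1 :: real)" for C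
    by (rule optimal_no_majority_shift[OF F opt _ S that(1,2) M _ that(3)])
      (use frac M that(1) in auto)
  have "(True, True) \<notin> ?T"
  proof
    assume "(True, True) \<in> ?T"
    then obtain j where "j \<in> {..<n} - F" "s1 ! j = s2 ! j" "s1 ! j = s3 ! j"
      by (auto simp: col_type_def)
    then show False
      by (intro no_shift[of "{j}"]) (auto simp: M_def)
  qed
  then have sub: "?T \<subseteq> {(True, False), (False, True), (False, False)}"
    by (auto simp: col_type_def)
  have "?T = {(True, False), (False, True), (False, False)}"
    by (rule card_seteq[OF _ sub]) (use big in auto)
  then have "(True, False) \<in> ?T" "(False, True) \<in> ?T" "(False, False) \<in> ?T"
    by blast+
  then obtain i j k where ijk: "i \<in> {..<n} - F" "j \<in> {..<n} - F" "k \<in> {..<n} - F"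
    and types: "(True, False) = col_type s1 s2 s3 i" "(False, True) = col_type s1 s2 s3 j"
      "(False, False) = col_type s1 s2 s3 k"
    by (elim imageE)
  have i: "s1 ! i = s2 ! i" "s1 ! i \<noteq> s3 ! i"
    using types(1) by (simp_all add: col_type_def)
  have j: "s1 ! j \<noteq> s2 ! j" "s1 ! j = s3 ! j"
    using types(2) by (simp_all add: col_type_def)
  have k: "s1 ! k \<noteq> s2 ! k" "s1 ! k \<noteq> s3 ! k"
    using types(3) by (simp_all add: col_type_def)
  have k': "s2 ! k = s3 ! k"
    using letter[of k] k ijk(3) by force
  have distinct: "i \<noteq> j" "i \<noteq> k" "j \<noteq> k"
    using i j k by metis+
  have M_ijk: "M i = s2 ! i" "M j = s3 ! j" "M k = s3 ! k"
    using i j k by (simp_all add: M_def)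
  \<comment> \<open>The minority strings in columns \<open>i\<close>, \<open>j\<close>,
    \<open>k\<close> are \<open>s3\<close>, \<open>s2\<close>, \<open>s1\<close>, so each string has
    the sum 1 + 1 - 1 = 1.\<close>
  show False
  proof (rule no_shift[of "{i, j, k}"])
    fix s assume "s \<in> {s1, s2, s3}"
    then consider "s = s1" | "s = s2" | "s = s3"
      by blast
    then show "1 \<le> (\<Sum>j\<in>{i, j, k}. if s ! j = M j then 1 else - 1 :: real)"
      by cases (use i j k k' distinct M_ijk in simp_all)
  qed (use ijk in auto)
qed

section \<open>Invariant and a single rounding step\<close>

text \<open>
  The bound \<open>D + 1\<close> on the LP value, with a credit of \<open>1/2\<close> kept for each of up to two column types
  still present among the unfixed columns.
\<close>

definition rounding_inv ::
  "nat \<Rightarrow> nat list \<Rightarrow> nat list \<Rightarrow> nat list \<Rightarrow> real \<Rightarrow> nat set \<Rightarrow> (nat \<Rightarrow> nat) \<Rightarrow> bool" where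
  "rounding_inv n s1 s2 s3 D F p \<longleftrightarrow>
    (\<exists>x d. lp_feasible {0, 1} n {s1, s2, s3} (fixed_to_one F p) (fixed_to_zero F p) x d \<and>
      d + real (min 2 (card (col_type s1 s2 s3 ` ({..<n} - F)))) / 2 \<le> D + 1)"

lemma rounding_inv_step:
  assumes F: "F \<subseteq> {..<n}" "p ` F \<subseteq> {0, 1}"
    and opt: "lp_optimal {0, 1} n {s1, s2, s3} (fixed_to_one F p) (fixed_to_zero F p) x d"
    and S: "{s1, s2, s3} \<subseteq> strings {0, 1} n"
    and inv: "rounding_inv n s1 s2 s3 D F p"
    and k: "k \<in> {..<n} - F" and b: "b \<in> {0, 1}"
    and largest: "\<And>j a. j \<in> {..<n} - F \<Longrightarrow> a \<in> {0, 1} \<Longrightarrow> x a j \<le> x b k"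
  shows "rounding_inv n s1 s2 s3 D (insert k F) (p(k := b))"
proof -
  let ?T = "\<lambda>F. col_type s1 s2 s3 ` ({..<n} - F)"
  have F': "insert k F \<subseteq> {..<n}" "(p(k := b)) ` insert k F \<subseteq> {0, 1}"
    using F k b by auto
  \<comment> \<open>The solution witnessing the invariant is feasible for the same fixing, so the
    optimal value \<open>d\<close> is no larger and inherits its bound.\<close>
  have bound: "d + real (min 2 (card (?T F))) / 2 \<le> D + 1"
    using inv opt unfolding rounding_inv_def lp_optimal_def by fastforce
  have feas: "unit_columns n x" "\<forall>j\<in>F. x (p j) j = 1"
    "\<forall>s\<in>{s1, s2, s3}. lp_cost n x s \<le> d" "0 \<le> d"
    using opt unfolding lp_optimal_def lp_feasible_binary_iff[OF F] by auto
  have u: "0 \<le> x 0 j \<and> 0 \<le> x 1 j \<and> x 0 j + x 1 j = 1" if "j < n" for j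
    using feas(1) that by (auto simp: unit_columns_def)
  have u': "0 \<le> x a j \<and> x a j \<le> 1" if "j < n" "a \<in> {0, 1}" for a j
    using u[OF that(1)] that(2) by auto
  have half: "1/2 \<le> x b k"
    using largest[OF k, of 0] largest[OF k, of 1] u[of k] k by auto
  have letter: "s ! j = 0 \<or> s ! j = 1" if "s \<in> {s1, s2, s3}" "j < n" for s j
    by (rule binary_letter[OF subsetD[OF S that(1)] that(2)])
  have mono: "card (?T (insert k F)) \<le> card (?T F)"
    by (intro card_mono) auto
  \<comment> \<open>The extended fixing needs only some feasible solution, not an optimal one. The
    premise \<open>d \<le> d'\<close> provides the constraint \<open>0 \<le> d'\<close>.\<close>
  have conclude: ?thesis
    if "unit_columns n x'" "\<And>j. j \<in> F \<Longrightarrow> x' (p j) j = 1" "x' b k = 1"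
      "\<And>s. s \<in> {s1, s2, s3} \<Longrightarrow> lp_cost n x' s \<le> d'" "d \<le> d'"
      "d' + real (min 2 (card (?T (insert k F)))) / 2
        \<le> d + real (min 2 (card (?T F))) / 2" for x' d'
  proof -
    have "\<forall>j\<in>insert k F. x' ((p(k := b)) j) j = 1"
      using that(2,3) by auto
    then have "lp_feasible {0, 1} n {s1, s2, s3}
        (fixed_to_one (insert k F) (p(k := b))) (fixed_to_zero (insert k F) (p(k := b))) x' d'"
      unfolding lp_feasible_binary_iff[OF F'] using that feas(4) by auto
    then show ?thesis
      unfolding rounding_inv_def using that(6) bound by (intro exI[of _ x'] exI[of _ d']) linarith
  qed
  \<comment> \<open>Either the chosen variable is already 1, or another unfixed column has the type
    of column \<open>k\<close>, or \<open>k\<close> is the last column of its type.\<close>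
  consider "x b k = 1" | k' where "x b k < 1" "k' \<in> {..<n} - F" "k' \<noteq> k"
      "col_type s1 s2 s3 k' = col_type s1 s2 s3 k"
    | "x b k < 1" "\<And>k'. k' \<in> {..<n} - F \<Longrightarrow> k' \<noteq> k \<Longrightarrow> col_type s1 s2 s3 k' \<noteq> col_type s1 s2 s3 k"
    using u'[of k b] k b by force
  then show ?thesis
  proof cases
    case 1
    then show ?thesis
      by (intro conclude[of x d]) (use feas mono in auto)
  next
    case 2
    \<comment> \<open>The letter held in column \<open>k'\<close> by exactly those strings that hold
      \<open>b\<close> in column \<open>k\<close>.\<close>
    define b' where "b' = (if b = s1 ! k then s1 ! k' else 1 - s1 ! k')"
    have b': "b' \<in> {0, 1}"
      using letter[of s1 k'] 2(2) by (auto simp: b'_def)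
    \<comment> \<open>By maximality the other letter of column \<open>k'\<close> has weight at most
      \<open>x b k\<close>, which leaves at least \<open>1 - x b k\<close> for
      \<open>b'\<close>.\<close>
    have room: "1 - x b k \<le> x b' k'"
      using largest[OF 2(2), of 0] largest[OF 2(2), of 1] u[of k'] 2(2) b' by auto
    define M where "M = (\<lambda>_. 0)(k := b, k' := b')"
    \<comment> \<open>Opposite changes in the two columns: what a string gains in one it loses in
      the other, so all costs are unchanged.\<close>
    define e where "e = (\<lambda>_. 0)(k := 1 - x b k, k' := x b k - 1)"
    have Me: "M k = b" "M k' = b'" "e k = 1 - x b k" "e k' = x b k - 1"
      using 2(3) by (simp_all add: M_def e_def)
    have M: "M j \<in> {0, 1}" for j
      using b b' by (auto simp: M_def)
    have unit: "unit_columns n (shift M e x)"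
    proof (rule unit_columns_shift[OF feas(1) M])
      fix j assume "j < n"
      then show "0 \<le> x (M j) j + e j \<and> x (M j) j + e j \<le> 1"
        using u'[of j 0] u'[of k' b'] room 2 b' by (auto simp: M_def e_def)
    qed
    have "lp_cost n (shift M e x) s = lp_cost n x s" if s: "s \<in> {s1, s2, s3}" for s
    proof -
      have "(s ! k = s1 ! k) = (s ! k' = s1 ! k')"
      proof -
        have "(s1 ! k' = s2 ! k') = (s1 ! k = s2 ! k)" "(s1 ! k' = s3 ! k') = (s1 ! k = s3 ! k)"
          using 2(4) by (simp_all add: col_type_def)
        moreover have "s = s1 \<or> s = s2 \<or> s = s3"
          using s by blast
        ultimately show ?thesis
          by (elim disjE) (simp_all add: eq_commute)
      qed
      moreover have "(s ! k = b) = ((s ! k = s1 ! k) = (b = s1 ! k))"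
      proof -
        have "s ! k = 0 \<or> s ! k = 1" "s1 ! k = 0 \<or> s1 ! k = 1" "b = 0 \<or> b = 1"
          using letter[OF s] letter[of s1] k b by simp_all
        then show ?thesis
          by (elim disjE) simp_all
      qed
      moreover have "(s ! k' = b') = ((s ! k' = s1 ! k') = (b = s1 ! k))"
      proof -
        have "s ! k' = 0 \<or> s ! k' = 1" "s1 ! k' = 0 \<or> s1 ! k' = 1"
          using letter[OF s] letter[of s1] 2(2) by simp_all
        then show ?thesis
          by (elim disjE) (simp_all add: b'_def)
      qed
      ultimately have "(s ! k = b) = (s ! k' = b')"
        by simp
      moreover have "(\<Sum>j<n. if s ! j = M j then e j else - e j)
          = (\<Sum>j\<in>{k, k'}. if s ! j = M j then e j else - e j)"
        by (rule sum.mono_neutral_right) (use k 2 in \<open>auto simp: e_def\<close>)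
      ultimately show ?thesis
        using 2(3) by (simp add: lp_cost_shift Me)
    qed
    then have cost: "lp_cost n (shift M e x) s \<le> d" if "s \<in> {s1, s2, s3}" for s
      using feas(3) that by metis
    have old: "shift M e x (p j) j = 1" if "j \<in> F" for j
      using that feas(2) k 2(2) by (auto simp: shift_def e_def)
    show ?thesis
      by (rule conclude[OF unit old _ cost]) (use mono in \<open>simp_all add: shift_def Me\<close>)
  next
    case 3
    define M where "M = (\<lambda>_. 0)(k := b)"
    define e where "e = (\<lambda>_. 0)(k := 1 - x b k)"
    have Me: "M k = b" "e k = 1 - x b k"
      by (simp_all add: M_def e_def)
    have M: "M j \<in> {0, 1}" for j
      using b by (auto simp: M_def)
    have unit: "unit_columns n (shift M e x)"
    proof (rule unit_columns_shift[OF feas(1) M])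
      fix j assume "j < n"
      then show "0 \<le> x (M j) j + e j \<and> x (M j) j + e j \<le> 1"
        using u'[of j 0] by (auto simp: M_def e_def)
    qed
    \<comment> \<open>Only column \<open>k\<close> changes, and by
      \<open>1 - x b k \<le> 1/2\<close>.\<close>
    have cost: "lp_cost n (shift M e x) s \<le> d + 1/2" if s: "s \<in> {s1, s2, s3}" for s
    proof -
      have "(\<Sum>j<n. if s ! j = M j then e j else - e j)
          = (\<Sum>j\<in>{k}. if s ! j = M j then e j else - e j)"
        by (rule sum.mono_neutral_right) (use k in \<open>auto simp: e_def\<close>)
      then have "lp_cost n (shift M e x) s \<le> lp_cost n x s + 1/2"
        using half 3(1) by (simp add: lp_cost_shift Me)
      then show ?thesis
        using feas(3) s by fastforce
    qed
    \<comment> \<open>Maximality makes all unfixed variables smaller than 1, so at most two types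
      are present and \<open>min 2\<close> does not truncate. The type of \<open>k\<close>
      disappears, and its credit of 1/2 pays for the rounding.\<close>
    have credit: "d + 1/2 + real (min 2 (card (?T (insert k F)))) / 2
        \<le> d + real (min 2 (card (?T F))) / 2"
    proof -
      have "card (?T F) \<le> 2"
        by (rule fractional_col_types[OF F opt S]) (use largest 3(1) in fastforce)+
      moreover have "?T F = insert (col_type s1 s2 s3 k) (?T (insert k F))"
        using k by auto
      moreover have "col_type s1 s2 s3 k \<notin> ?T (insert k F)"
        using 3(2) by fastforce
      ultimately have "card (?T F) = Suc (card (?T (insert k F)))" "card (?T F) \<le> 2"
        by auto
      then show ?thesis
        by simp
    qed
    have old: "shift M e x (p j) j = 1" if "j \<in> F" for j
      using that feas(2) k by (auto simp: shift_def e_def)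
    show ?thesis
      by (rule conclude[OF unit old _ cost _ credit]) (simp_all add: shift_def Me)
  qed
qed

section \<open>Runs of the algorithm\<close>

text \<open>Apart from the rounding step, the point is that each iteration fixes a new column, so
  that \<open>n\<close> iterations fix all of them.\<close>

lemma algA_state_inv:
  assumes "algA_state {0, 1} n {s1, s2, s3} i V1 V0"
    and S: "{s1, s2, s3} \<subseteq> strings {0, 1} n"
    and init: "rounding_inv n s1 s2 s3 D {} (\<lambda>_. 0)"
  shows "\<exists>F p. F \<subseteq> {..<n} \<and> card F = i \<and> p ` F \<subseteq> {0, 1} \<and> V1 = fixed_to_one F p \<and>
    V0 = fixed_to_zero F p \<and> rounding_inv n s1 s2 s3 D F p"
  using assms(1)
proof induction
  case init
  show ?case
    by (rule exI[of _ "{}"], rule exI[of _ "\<lambda>_. 0"])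
      (use assms(3) in \<open>simp add: fixed_to_one_def fixed_to_zero_def\<close>)
next
  case (step i V1 V0 x d b k)
  then obtain F p where F: "F \<subseteq> {..<n}" "card F = i" "p ` F \<subseteq> {0, 1}"
    and V: "V1 = fixed_to_one F p" "V0 = fixed_to_zero F p" and inv: "rounding_inv n s1 s2 s3 D F p"
    by blast
  have unfixed: "(a, j) \<notin> V1" if "j \<in> {..<n} - F" for a j
    using that V by (auto simp: fixed_to_one_def)
  have largest: "x a j \<le> x b k" if "j \<in> {..<n} - F" "a \<in> {0, 1}" for a j
    using step.hyps(7)[of a j] unfixed[of j a] that by auto
  have feas: "unit_columns n x" "\<forall>j\<in>F. x (p j) j = 1"
    using step.hyps(3) unfolding lp_optimal_def V lp_feasible_binary_iff[OF F(1,3)] by auto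
  \<comment> \<open>The rule excludes only variables in \<open>V1\<close>, so one in
    \<open>V0\<close> might be picked. Its value would be 0, whereas \<open>i < n\<close> leaves an
    unfixed column, and one of its variables is at least 1/2.\<close>
  have k: "k \<in> {..<n} - F"
  proof (rule ccontr)
    assume "k \<notin> {..<n} - F"
    then have "k \<in> F"
      using step.hyps by auto
    moreover have "b \<noteq> p k"
      using step.hyps(6) \<open>k \<in> F\<close> V by (auto simp: fixed_to_one_def)
    moreover have "p k = 0 \<or> p k = 1" "b = 0 \<or> b = 1"
      using F(3) \<open>k \<in> F\<close> step.hyps(4) by auto
    moreover have "x 0 k + x 1 k = 1" "x (p k) k = 1"
      using feas step.hyps(5) \<open>k \<in> F\<close> by (auto simp: unit_columns_def)
    ultimately have "x b k = 0"
      by auto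
    moreover obtain j where "j \<in> {..<n} - F"
      using F(1,2) \<open>i < n\<close> by (metis Diff_eq_empty_iff all_not_in_conv card_lessThan nless_le subset_antisym)
    then have "x 0 j + x 1 j \<le> 2 * x b k" "x 0 j + x 1 j = 1"
      using largest[of j 0] largest[of j 1] feas(1) by (auto simp: unit_columns_def)
    ultimately show False
      by simp
  qed
  have "rounding_inv n s1 s2 s3 D (insert k F) (p(k := b))"
    by (rule rounding_inv_step[OF F(1,3) step.hyps(3)[unfolded V] S inv k step.hyps(4) largest])
  moreover have "insert (b, k) V1 = fixed_to_one (insert k F) (p(k := b))"
    using k V by (auto simp: fixed_to_one_def)
  moreover have "{(a, k) |a. a \<in> {0, 1} \<and> a \<noteq> b} = {(1 - b, k)}"
    using step.hyps(4) by auto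
  then have "V0 \<union> {(a, k) |a. a \<in> {0, 1} \<and> a \<noteq> b} = fixed_to_zero (insert k F) (p(k := b))"
    using k V by (auto simp: fixed_to_zero_def)
  moreover have "card (insert k F) = Suc i"
    using F(1,2) k finite_subset[OF F(1)] by simp
  moreover have "insert k F \<subseteq> {..<n}" "(p(k := b)) ` insert k F \<subseteq> {0, 1}"
    using F k step.hyps(4) by auto
  ultimately show ?case
    by blast
qed

section \<open>From the invariant to the error bound\<close>

lemma opt_dist_attained:
  assumes "finite A" and "strings A n \<noteq> {}"
  obtains u where "u \<in> strings A n" and "max_dist u S = opt_dist A n S"
proof -
  have "finite (strings A n)"
    using finite_lists_length_eq[OF assms(1)] by (simp add: strings_def)
  then have "opt_dist A n S \<in> (\<lambda>u. max_dist u S) ` strings A n"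
    unfolding opt_dist_def using assms(2) by (intro Min_in) auto
  then show ?thesis
    using that by auto
qed

theorem theorem2:
  fixes n :: nat and s1 s2 s3 t :: "nat list"
  assumes "s1 \<in> strings {0, 1} n" and "s2 \<in> strings {0, 1} n" and "s3 \<in> strings {0, 1} n"
    and "algA_output {0, 1} n {s1, s2, s3} t"
  shows "int (max_dist t {s1, s2, s3}) - int (opt_dist {0, 1} n {s1, s2, s3}) \<le> 1"
proof -
  let ?S = "{s1, s2, s3}" and ?D = "real (opt_dist {0, 1} n {s1, s2, s3})"
  have S: "?S \<subseteq> strings {0, 1} n"
    using assms by auto
  obtain u where u: "u \<in> strings {0, 1} n" "max_dist u ?S = opt_dist {0, 1} n ?S"
    using opt_dist_attained[of "{0, 1}" n ?S] assms(1) by blast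
  \<comment> \<open>The indicator solution of an optimal string \<open>u\<close>, feasible with
    value \<open>?D\<close>.\<close>
  define y where "y a j = (if a = u ! j then 1 else 0 :: real)" for a j
  have y: "unit_columns n y"
    unfolding unit_columns_def
  proof (intro allI impI)
    fix j assume "j < n"
    then show "0 \<le> y 0 j \<and> 0 \<le> y 1 j \<and> y 0 j + y 1 j = 1"
      using binary_letter[OF u(1)] by (fastforce simp: y_def)
  qed
  have cost: "lp_cost n y s \<le> ?D" if "s \<in> ?S" for s
  proof -
    have "hamming u s \<le> max_dist u ?S"
      unfolding max_dist_def using that by (intro Max_ge) auto
    then show ?thesis
      using lp_cost_integral[OF y u(1), of s] that S u(2) by (auto simp: y_def)
  qed
  have "lp_feasible {0, 1} n ?S (fixed_to_one {} (\<lambda>_. 0)) (fixed_to_zero {} (\<lambda>_. 0)) y ?D"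
    by (subst lp_feasible_binary_iff) (use y cost in auto)
  \<comment> \<open>Up to four types may be present at the start, but \<open>min 2\<close> caps the
    credit at 1, which is the slack in \<open>?D + 1\<close>.\<close>
  then have init: "rounding_inv n s1 s2 s3 ?D {} (\<lambda>_. 0)"
    unfolding rounding_inv_def by (intro exI[of _ y] exI[of _ ?D]) auto
  obtain V1 V0 where V: "t \<in> strings {0, 1} n" "algA_state {0, 1} n ?S n V1 V0"
    "\<forall>(a, k)\<in>V1. t ! k = a"
    using assms(4) by (auto simp: algA_output_def)
  obtain F p where F: "F \<subseteq> {..<n}" "card F = n" "p ` F \<subseteq> {0, 1}"
    and V1: "V1 = fixed_to_one F p" and inv: "rounding_inv n s1 s2 s3 ?D F p"
    using algA_state_inv[OF V(2) S init] by blast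
  have all: "F = {..<n}"
    using F(1,2) by (intro card_subset_eq) auto
  \<comment> \<open>No unfixed column is left, so the remaining credit is 0 and the invariant bounds
    \<open>d\<close> itself.\<close>
  obtain x d where "lp_feasible {0, 1} n ?S (fixed_to_one F p) (fixed_to_zero F p) x d"
    and d: "d \<le> ?D + 1"
    using inv unfolding rounding_inv_def all by auto
  then have x: "unit_columns n x" "\<forall>j\<in>F. x (p j) j = 1" "\<forall>s\<in>?S. lp_cost n x s \<le> d"
    unfolding lp_feasible_binary_iff[OF F(1,3)] by auto
  have "x (t ! j) j = 1" if "j < n" for j
    using x(2) V(3) V1 all that by (auto simp: fixed_to_one_def)
  then have "real (hamming t s) \<le> ?D + 1" if "s \<in> ?S" for s
    using lp_cost_integral[OF x(1) V(1), of s] x(3) S d that by fastforce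
  then have "hamming t s \<le> opt_dist {0, 1} n ?S + 1" if "s \<in> ?S" for s
    using that by (metis of_nat_1 of_nat_add of_nat_le_iff)
  then have "max_dist t ?S \<le> opt_dist {0, 1} n ?S + 1"
    unfolding max_dist_def by (subst Max_le_iff) auto
  then show ?thesis
    by simp
qed

end
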